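(* Let $P$ be a finite super-atomic lattice with atoms $a_1,\dots,a_n$ and top element $\hat 1$, and let $\mathcal{C}$ be the labeling $m_p=\prod_{a_i\in\mathrm{supp}(p)}a_i$ for $p\in P\setminus\{0\}$ (each atom $a_i$ also regarded as a variable of $K[a_1,\dots,a_n]$, $K$ a field). Then $\mathcal{C}$ is a strong coordinatization of $P$ if and only if for every $p\in P$, every $a_i,a_j\in\mathrm{supp}(p)$ with $p=a_i\vee a_j$, and every $a_k,a_r\in\mathrm{supp}(p)$, either $N([a_i\vee a_k,\hat 1])\le N([a_r\vee a_k,\hat 1])$ or $N([a_j\vee a_k,\hat 1])\le N([a_r\vee a_k,\hat 1])$.
   Context: A finite atomic lattice is a finite lattice with least element $0$ and greatest element $\hat 1$ in which every nonzero element is a join of atoms. $\mathrm{supp}(p)=\{a\in\mathrm{atoms}(P): a\le p\}$; $B_p=\{T\subseteq\mathrm{supp}(p):\bigvee_{b\in T}b=p\}$. $P$ is super-atomic if for every $p\in P$ that is neither $0$ nor an atom, and every $T\in B_p$, there exist exactly two elements $a,b\in T$ with $a\vee b=p$. $[a,b]=\{p\in P:a\le p\le b\}$ and $N([a,b])=|[a,b]|$. For $p\in P$, $\lceil p\rceil=\{q:q\ge p\}$, $\lceil p\rceil^c=P\setminus\lceil p\rceil$. A labeling assigns monomials $m_p$ to elements (here $m_0=1$). For an atom $a$ let $x(a)=\prod_{p\in\lceil a\rceil^c}m_p$, and let $M_{P,\mathcal{C}}$ be the monomial ideal generated by all $x(a)$. The lcm-lattice $LCM(I)$ of a monomial ideal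 $I$ is the set of least common multiples of subsets of its minimal generators, ordered by divisibility. The labeling is a strong coordinatization of $P$ if there is a lattice isomorphism $g:P\to LCM(M_{P,\mathcal{C}})$ with $g(a)=x(a)$ for every atom $a$.
   Formalization: The case of exactly one atom (n = 1) is excluded: there P = {0, a}, x(a) = 1 and the lcm-lattice has one element, so the labeling is not a strong coordinatization although the inequalities hold trivially. *)

theory Defs
  imports Complex_Main "HOL-Library.Poly_Mapping"
begin

text \<open>A finite lattice is a type of class \<open>finite\<close> and \<open>complete_lattice\<close>: a (nonempty) finite lattice
  has all joins and meets, and \<^term>\<open>bot\<close> and \<^term>\<open>top\<close> are its elements \<open>0\<close> and \<open>1\<close>.\<close>

definition atoms :: "'p::{finite,complete_lattice} set" where
  "atoms = {a. a \<noteq> bot \<and> (\<forall>q. q < a \<longrightarrow> q = bot)}"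

definition supp :: "'p::{finite,complete_lattice} \<Rightarrow> 'p set" where
  "supp p = {a \<in> atoms. a \<le> p}"

definition atomic_lattice :: "'p::{finite,complete_lattice} itself \<Rightarrow> bool" where
  "atomic_lattice _ \<longleftrightarrow> (\<forall>p::'p. p \<noteq> bot \<longrightarrow> (\<exists>T \<subseteq> atoms. p = Sup T))"

definition join_sets :: "'p::{finite,complete_lattice} \<Rightarrow> 'p set set" where
  "join_sets p = {T. T \<subseteq> supp p \<and> Sup T = p}"

text \<open>``Exactly two elements \<open>a, b\<close> of \<open>T\<close> with join \<open>p\<close>'' is read literally: there is one
  and only one unordered pair of distinct elements of \<open>T\<close> whose join is \<open>p\<close>.\<close>

definition super_atomic :: "'p::{finite,complete_lattice} itself \<Rightarrow> bool" where
  "super_atomic _ \<longleftrightarrow> atomic_lattice TYPE('p) \<and>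
     (\<forall>p::'p. p \<noteq> bot \<and> p \<notin> atoms \<longrightarrow>
       (\<forall>T \<in> join_sets p. \<exists>a \<in> T. \<exists>b \<in> T. a \<noteq> b \<and> sup a b = p \<and>
         (\<forall>c \<in> T. \<forall>d \<in> T. sup c d = p \<longrightarrow> {c, d} = {a, b})))"

text \<open>Polynomials with variables in \<open>'v\<close>: finitely supported maps from exponent vectors to
  coefficients. The ring \<open>K[V]\<close> for a set \<open>V\<close> of variables is \<open>polys V\<close>.\<close>

type_synonym ('v, 'k) mpoly = "('v \<Rightarrow>\<^sub>0 nat) \<Rightarrow>\<^sub>0 'k"

definition polys :: "'v set \<Rightarrow> ('v, 'k::field) mpoly set" where
  "polys V = {f. \<forall>m \<in> Poly_Mapping.keys f. Poly_Mapping.keys m \<subseteq> V}"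

definition Var :: "'v \<Rightarrow> ('v, 'k::field) mpoly" where
  "Var v = Poly_Mapping.single (Poly_Mapping.single v 1) 1"

definition monomials :: "'v set \<Rightarrow> ('v, 'k::field) mpoly set" where
  "monomials V = {Poly_Mapping.single m 1 | m. Poly_Mapping.keys m \<subseteq> V}"

definition ideal_gen :: "'v set \<Rightarrow> ('v, 'k::field) mpoly set \<Rightarrow> ('v, 'k) mpoly set" where
  "ideal_gen V S = {\<Sum>s \<in> F. q s * s | F q. finite F \<and> F \<subseteq> S \<and> (\<forall>s \<in> F. q s \<in> polys V)}"

text \<open>Every monomial ideal has exactly one irredundant set of monomial generators; on ideals of
  \<open>K[V]\<close> that are not monomial ideals \<open>min_gens\<close> is meaningless.\<close>

definition min_gens :: "'v set \<Rightarrow> ('v, 'k::field) mpoly set \<Rightarrow> ('v, 'k) mpoly set" where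
  "min_gens V I = (THE G. G \<subseteq> monomials V \<and> ideal_gen V G = I \<and> (\<forall>H. H \<subset> G \<longrightarrow> ideal_gen V H \<noteq> I))"

text \<open>Below, \<open>dvd\<close> is divisibility in the ambient polynomial ring, which on elements of
  \<open>monomials V\<close> agrees with divisibility in \<open>polys V\<close>.\<close>

definition is_lcm :: "'v set \<Rightarrow> ('v, 'k::field) mpoly set \<Rightarrow> ('v, 'k) mpoly \<Rightarrow> bool" where
  "is_lcm V S l \<longleftrightarrow> l \<in> monomials V \<and> (\<forall>s \<in> S. s dvd l) \<and>
     (\<forall>m \<in> monomials V. (\<forall>s \<in> S. s dvd m) \<longrightarrow> l dvd m)"

definition lcm_lattice :: "'v set \<Rightarrow> ('v, 'k::field) mpoly set \<Rightarrow> ('v, 'k) mpoly set" where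
  "lcm_lattice V I = {l. \<exists>S. S \<subseteq> min_gens V I \<and> is_lcm V S l}"

definition is_join_in :: "('m \<Rightarrow> 'm \<Rightarrow> bool) \<Rightarrow> 'm set \<Rightarrow> 'm \<Rightarrow> 'm \<Rightarrow> 'm \<Rightarrow> bool" where
  "is_join_in le L u v w \<longleftrightarrow> w \<in> L \<and> le u w \<and> le v w \<and> (\<forall>z \<in> L. le u z \<and> le v z \<longrightarrow> le w z)"

definition is_meet_in :: "('m \<Rightarrow> 'm \<Rightarrow> bool) \<Rightarrow> 'm set \<Rightarrow> 'm \<Rightarrow> 'm \<Rightarrow> 'm \<Rightarrow> bool" where
  "is_meet_in le L u v w \<longleftrightarrow> w \<in> L \<and> le w u \<and> le w v \<and> (\<forall>z \<in> L. le z u \<and> le z v \<longrightarrow> le z w)"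

definition lattice_iso ::
  "('m \<Rightarrow> 'm \<Rightarrow> bool) \<Rightarrow> 'm set \<Rightarrow> ('p::{finite,complete_lattice} \<Rightarrow> 'm) \<Rightarrow> bool" where
  "lattice_iso le L g \<longleftrightarrow> bij_betw g UNIV L \<and>
     (\<forall>p q. is_join_in le L (g p) (g q) (g (sup p q)) \<and> is_meet_in le L (g p) (g q) (g (inf p q)))"

definition xmon :: "('p::{finite,complete_lattice} \<Rightarrow> ('v, 'k::field) mpoly) \<Rightarrow> 'p \<Rightarrow> ('v, 'k) mpoly" where
  "xmon C a = (\<Prod>p \<in> - {a..}. C p)"

definition coord_ideal :: "'v set \<Rightarrow> ('p::{finite,complete_lattice} \<Rightarrow> ('v, 'k::field) mpoly) \<Rightarrow> ('v, 'k) mpoly set" where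
  "coord_ideal V C = ideal_gen V (xmon C ` atoms)"

definition strong_coordinatization ::
  "'v set \<Rightarrow> ('p::{finite,complete_lattice} \<Rightarrow> ('v, 'k::field) mpoly) \<Rightarrow> bool" where
  "strong_coordinatization V C \<longleftrightarrow> (\<forall>p. C p \<in> monomials V) \<and>
     (\<exists>g. lattice_iso (dvd) (lcm_lattice V (coord_ideal V C)) g \<and> (\<forall>a \<in> atoms. g a = xmon C a))"

text \<open>At \<^term>\<open>bot\<close> the product is empty, so this labeling has \<open>m_0 = 1\<close>.\<close>

definition supp_label :: "'p::{finite,complete_lattice} \<Rightarrow> ('p, 'k::field) mpoly" where
  "supp_label p = (\<Prod>a \<in> supp p. Var a)"

end

theory Submission
  imports Defs
begin

text \<open>The exponent of an atom \<open>k\<close> in \<open>x(a)\<close> is the number of elements above \<open>k\<close> but not above \<open>a\<close>,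
  that is \<open>N([k, 1]) - N([a \<squnion> k, 1])\<close>. Hence the inequalities of the theorem say that \<open>x(a\<^sub>r)\<close> divides
  \<open>lcm(x(a\<^sub>i), x(a\<^sub>j))\<close> whenever \<open>a\<^sub>r \<le> a\<^sub>i \<squnion> a\<^sub>j\<close>, as far as the variables \<open>a\<^sub>k \<le> a\<^sub>i \<squnion> a\<^sub>j\<close> are concerned.
  For the other variables super-atomicity, applied to \<open>{a\<^sub>i, a\<^sub>j, a\<^sub>k}\<close>, gives \<open>a\<^sub>r \<le> a\<^sub>i \<squnion> a\<^sub>k\<close> or
  \<open>a\<^sub>r \<le> a\<^sub>j \<squnion> a\<^sub>k\<close>, which suffices. The same argument shows that \<open>x(a)\<close> never divides the lcm of the
  \<open>x(b)\<close>, \<open>b \<le> p\<close>, when \<open>a\<close> is not below \<open>p\<close>, so the \<open>x(a)\<close> are minimal generators and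
  \<open>p \<mapsto> lcm {x(b) | b \<le> p}\<close> reflects the order.\<close>

section \<open>Monomials and monomial ideals\<close>

abbreviation lookup :: "('v \<Rightarrow>\<^sub>0 nat) \<Rightarrow> 'v \<Rightarrow> nat" where
  "lookup \<equiv> Poly_Mapping.lookup"

abbreviation mon :: "('v \<Rightarrow>\<^sub>0 nat) \<Rightarrow> ('v, 'k::field) mpoly" where
  "mon m \<equiv> Poly_Mapping.single m 1"

lemma le_imp_add_poly_mapping:
  fixes m n :: "'v \<Rightarrow>\<^sub>0 nat"
  assumes "\<And>v. lookup m v \<le> lookup n v"
  shows "m + (n - m) = n"
  using assms by (intro poly_mapping_eqI) (simp add: lookup_add lookup_minus)

text \<open>The cofactor may be any polynomial; \<open>keys_mult\<close> still writes
  \<open>n\<close> as \<open>m + d\<close>. Conversely \<open>mon (n - m)\<close> is a cofactor,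
  since truncated subtraction is exact when \<open>m\<close> lies pointwise below
  \<open>n\<close>.\<close>

lemma mon_dvd_iff:
  "(mon m :: ('v, 'k::field) mpoly) dvd mon n \<longleftrightarrow> (\<forall>v. lookup m v \<le> lookup n v)"
proof
  assume "(mon m :: ('v, 'k) mpoly) dvd mon n"
  then obtain f :: "('v, 'k) mpoly" where f: "mon n = mon m * f" by (auto simp: dvd_def)
  have "n \<in> Poly_Mapping.keys (mon m * f)" by (simp flip: f)
  then obtain d where "n = m + d" using keys_mult[of "mon m" f] by auto
  then show "\<forall>v. lookup m v \<le> lookup n v" by (simp add: lookup_add)
next
  assume "\<forall>v. lookup m v \<le> lookup n v"
  then have "mon n = (mon m * mon (n - m) :: ('v, 'k) mpoly)"
    by (simp add: mult_single le_imp_add_poly_mapping)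
  then show "(mon m :: ('v, 'k) mpoly) dvd mon n" by simp
qed

lemma monomials_dvd_antisym:
  assumes "f \<in> monomials V" "g \<in> monomials V" "f dvd g" "g dvd f"
  shows "f = g"
proof -
  obtain m n where mn: "f = mon m" "g = mon n" using assms by (auto simp: monomials_def)
  have "m = n" using assms(3,4) by (auto simp: mn mon_dvd_iff intro: poly_mapping_eqI le_antisym)
  then show ?thesis by (simp add: mn)
qed

lemma prod_mon:
  "(\<Prod>x\<in>A. (mon (f x) :: ('v, 'k::field) mpoly)) = mon (\<Sum>x\<in>A. f x)"
  by (induction A rule: infinite_finite_induct) (simp_all add: mult_single)

text \<open>The exponent vector of \<open>f\<close> must occur in some summand
  \<open>q s * s\<close>, where every exponent vector is a sum of one from \<open>q s\<close> and
  that of \<open>s\<close>.\<close>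

lemma monomial_in_ideal_gen_iff:
  fixes f :: "('v, 'k::field) mpoly"
  assumes G: "G \<subseteq> monomials V" and f: "f \<in> monomials V"
  shows "f \<in> ideal_gen V G \<longleftrightarrow> (\<exists>g\<in>G. g dvd f)"
proof
  obtain n where n: "f = mon n" "Poly_Mapping.keys n \<subseteq> V" using f by (auto simp: monomials_def)
  {
    assume "f \<in> ideal_gen V G"
    then obtain F q where F: "F \<subseteq> G" "finite F" "f = (\<Sum>s\<in>F. q s * s)" by (auto simp: ideal_gen_def)
    have "n \<in> Poly_Mapping.keys f" by (simp add: n)
    then obtain s where s: "s \<in> F" "n \<in> Poly_Mapping.keys (q s * s)"
      using keys_sum[of "\<lambda>s. q s * s" F] F by auto
    obtain m where m: "s = mon m" using s F G by (auto simp: monomials_def)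
    obtain d where "n = d + m" using s keys_mult[of "q s" s] by (auto simp: m)
    then have "s dvd f" by (simp add: m n mon_dvd_iff lookup_add)
    then show "\<exists>g\<in>G. g dvd f" using s F by auto
  }
  {
    assume "\<exists>g\<in>G. g dvd f"
    then obtain m where m: "mon m \<in> G" "(mon m :: ('v, 'k) mpoly) dvd f"
      using G by (force simp: monomials_def)
    have "m + (n - m) = n"
      using m(2) by (intro le_imp_add_poly_mapping) (simp add: n mon_dvd_iff)
    then have "f = (\<Sum>s\<in>{mon m}. mon (n - m) * s)"
      by (simp add: n mult_single add.commute)
    \<comment> \<open>Subtraction only lowers exponents, so the cofactor stays in the ring
      \<open>polys V\<close>.\<close>
    moreover have "Poly_Mapping.keys (n - m) \<subseteq> V"
      using n(2) by (auto simp: in_keys_iff lookup_minus subset_iff)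
    then have "(mon (n - m) :: ('v, 'k) mpoly) \<in> polys V" by (simp add: polys_def)
    ultimately show "f \<in> ideal_gen V G"
      unfolding ideal_gen_def using m(1)
      by (intro CollectI exI[of _ "{mon m}"] exI[of _ "\<lambda>_. mon (n - m)"]) auto
  }
qed

text \<open>This evaluates the \<open>THE\<close> in \<open>min_gens\<close>. A generator dropped
  from \<open>G\<close> would need a divisor among the remaining ones, so \<open>G\<close> is
  irredundant.\<close>

lemma min_gens_antichain:
  fixes G :: "('v, 'k::field) mpoly set"
  assumes G: "G \<subseteq> monomials V"
    and antichain: "\<And>f g. f \<in> G \<Longrightarrow> g \<in> G \<Longrightarrow> f dvd g \<Longrightarrow> f = g"
  shows "min_gens V (ideal_gen V G) = G"
proof -
  have in_ideal: "g \<in> ideal_gen V H" if "H \<subseteq> monomials V" "g \<in> H" for g and H :: "('v, 'k) mpoly set"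
    using that by (subst monomial_in_ideal_gen_iff) (auto intro: bexI[of _ g])
  have divisor: "\<exists>h\<in>H. h dvd g" if "H \<subseteq> monomials V" "g \<in> monomials V" "g \<in> ideal_gen V H"
    for g and H :: "('v, 'k) mpoly set"
    using that by (simp add: monomial_in_ideal_gen_iff)
  show ?thesis
    unfolding min_gens_def
  proof (rule the_equality)
    show "G \<subseteq> monomials V \<and> ideal_gen V G = ideal_gen V G \<and>
      (\<forall>H. H \<subset> G \<longrightarrow> ideal_gen V H \<noteq> ideal_gen V G)"
    proof (intro conjI allI impI refl G notI)
      fix H assume H: "H \<subset> G" and eq: "ideal_gen V H = ideal_gen V G"
      then obtain g where g: "g \<in> G" "g \<notin> H" by auto
      have "g \<in> ideal_gen V H" using in_ideal[OF G g(1)] eq by simp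
      moreover have "H \<subseteq> monomials V" "g \<in> monomials V" using H G g by auto
      ultimately obtain h where "h \<in> H" "h dvd g" using divisor by meson
      then show False using antichain[of h g] H g by auto
    qed
  next
    fix G' assume *: "G' \<subseteq> monomials V \<and> ideal_gen V G' = ideal_gen V G \<and>
      (\<forall>H. H \<subset> G' \<longrightarrow> ideal_gen V H \<noteq> ideal_gen V G)"
    then have G': "G' \<subseteq> monomials V" and eq: "ideal_gen V G' = ideal_gen V G" by auto
    \<comment> \<open>Each \<open>g\<close> in \<open>G\<close> has a divisor \<open>h'\<close> in
      \<open>G'\<close>, which has a divisor \<open>h\<close> in \<open>G\<close>; the antichain
      property gives \<open>h = g\<close>, and the chain of divisors collapses.\<close>
    have "G \<subseteq> G'"
    proof
      fix g assume g: "g \<in> G"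
      have "g \<in> ideal_gen V G'" using in_ideal[OF G g] eq by simp
      then obtain h' where h': "h' \<in> G'" "h' dvd g" using divisor[OF G'] g G by (meson subsetD)
      have "h' \<in> ideal_gen V G" using in_ideal[OF G' h'(1)] eq by simp
      then obtain h where h: "h \<in> G" "h dvd h'" using divisor[OF G] h' G' by (meson subsetD)
      have "h = g" using antichain[OF h(1) g] dvd_trans[OF h(2) h'(2)] by simp
      then have "h' = g"
        using monomials_dvd_antisym[OF subsetD[OF G' h'(1)] subsetD[OF G g] h'(2)] h(2) by simp
      then show "g \<in> G'" using h' by simp
    qed
    then show "G' = G" using * by (metis psubsetI)
  qed
qed

text \<open>Inserting 0 keeps \<open>Max\<close> meaningful for empty \<open>M\<close>: the lcm of
  no monomials is 1, which will be the image of \<open>bot\<close>.\<close>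

definition lcm_exp :: "('v \<Rightarrow>\<^sub>0 nat) set \<Rightarrow> 'v \<Rightarrow>\<^sub>0 nat" where
  "lcm_exp M = Abs_poly_mapping (\<lambda>v. Max (insert 0 ((\<lambda>m. lookup m v) ` M)))"

lemma lookup_lcm_exp:
  assumes "finite M"
  shows "lookup (lcm_exp M) v = Max (insert 0 ((\<lambda>m. lookup m v) ` M))"
proof -
  define e where "e v = Max (insert 0 ((\<lambda>m. lookup m v) ` M))" for v
  \<comment> \<open>\<open>Abs_poly_mapping\<close> is only usable for finite support; a nonzero
    maximum is attained at some \<open>m\<close> in \<open>M\<close>, so it lies over a key of
    \<open>m\<close>.\<close>
  have "{v. e v \<noteq> 0} \<subseteq> (\<Union>m\<in>M. Poly_Mapping.keys m)"
  proof
    fix v assume v: "v \<in> {v. e v \<noteq> 0}"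
    have "e v \<in> insert 0 ((\<lambda>m. lookup m v) ` M)"
      unfolding e_def by (intro Max_in) (use assms in auto)
    then obtain m where "m \<in> M" "lookup m v = e v" using v by auto
    then show "v \<in> (\<Union>m\<in>M. Poly_Mapping.keys m)"
      using v by (intro UN_I[of m]) (simp_all add: in_keys_iff)
  qed
  then have "finite {v. e v \<noteq> 0}"
    by (rule finite_subset) (use assms in simp)
  then have "lookup (Abs_poly_mapping e) v = e v" by simp
  then show ?thesis by (simp only: lcm_exp_def e_def[abs_def])
qed

lemma le_lookup_lcm_exp_iff:
  assumes "finite M"
  shows "n \<le> lookup (lcm_exp M) v \<longleftrightarrow> n = 0 \<or> (\<exists>m\<in>M. n \<le> lookup m v)"
  using assms by (simp add: lookup_lcm_exp Max_ge_iff)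

lemma lookup_lcm_exp_le_iff:
  assumes "finite M"
  shows "lookup (lcm_exp M) v \<le> n \<longleftrightarrow> (\<forall>m\<in>M. lookup m v \<le> n)"
  using assms by (simp add: lookup_lcm_exp)

lemma keys_lcm_exp:
  assumes "finite M"
  shows "Poly_Mapping.keys (lcm_exp M) \<subseteq> (\<Union>m\<in>M. Poly_Mapping.keys m)"
  using le_lookup_lcm_exp_iff[OF assms, of "Suc 0"] by (fastforce simp: in_keys_iff Suc_le_eq)

lemma is_lcm_lcm_exp:
  assumes "finite M" "(\<Union>m\<in>M. Poly_Mapping.keys m) \<subseteq> V"
  shows "is_lcm V (mon ` M) (mon (lcm_exp M) :: ('v, 'k::field) mpoly)"
proof -
  have "Poly_Mapping.keys (lcm_exp M) \<subseteq> V" using assms keys_lcm_exp[OF assms(1)] by blast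
  then have "(mon (lcm_exp M) :: ('v, 'k) mpoly) \<in> monomials V" unfolding monomials_def by blast
  then show ?thesis
    unfolding is_lcm_def
  proof (intro conjI ballI impI)
    fix f :: "('v, 'k) mpoly"
    assume "f \<in> monomials V" "\<forall>s\<in>mon ` M. s dvd f"
    then show "mon (lcm_exp M) dvd f"
      using assms(1) by (auto simp: monomials_def mon_dvd_iff lookup_lcm_exp_le_iff)
  qed (use assms(1) in \<open>auto simp: mon_dvd_iff le_lookup_lcm_exp_iff\<close>)
qed

lemma is_lcm_unique:
  assumes "is_lcm V S l" "is_lcm V S l'"
  shows "l = l'"
  using assms monomials_dvd_antisym[of l V l'] by (auto simp: is_lcm_def)

section \<open>The exponents of the support labeling\<close>

definition xexp :: "'p::{finite,complete_lattice} \<Rightarrow> 'p \<Rightarrow>\<^sub>0 nat" where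
  "xexp a = (\<Sum>p\<in>-{a..}. \<Sum>b\<in>supp p. Poly_Mapping.single b 1)"

lemma supp_label_eq_mon: "supp_label p = mon (\<Sum>b\<in>supp p. Poly_Mapping.single b 1)"
  by (simp add: supp_label_def Var_def prod_mon)

lemma xmon_supp_label: "xmon supp_label a = mon (xexp a)"
  by (simp add: xmon_def supp_label_eq_mon prod_mon xexp_def)

lemma lookup_sum_single:
  "finite A \<Longrightarrow> lookup (\<Sum>b\<in>A. Poly_Mapping.single b (1::nat)) k = (if k \<in> A then 1 else 0)"
  by (simp add: lookup_sum lookup_single when_def)

text \<open>Each factor m_p of x(a) is squarefree and contains the variable \<open>k\<close> exactly
  when \<open>k\<close> is in \<open>supp p\<close>.\<close>

lemma lookup_xexp: "lookup (xexp a) k = card {p. k \<in> supp p \<and> \<not> a \<le> p}"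
proof -
  have "lookup (xexp a) k = (\<Sum>p\<in>-{a..}. if k \<in> supp p then 1 else 0)"
    by (simp add: xexp_def lookup_sum[of _ "- {a..}"] lookup_sum_single del: One_nat_def)
  also have "\<dots> = card {p. k \<in> supp p \<and> \<not> a \<le> p}"
    by (simp flip: sum.inter_filter add: conj_commute)
  finally show ?thesis .
qed

lemma keys_xexp: "Poly_Mapping.keys (xexp a) \<subseteq> atoms"
  by (auto simp: in_keys_iff lookup_xexp supp_def)

lemma supp_label_in_monomials: "supp_label p \<in> monomials atoms"
proof -
  have "Poly_Mapping.keys (\<Sum>b\<in>supp p. Poly_Mapping.single b (1::nat)) \<subseteq> atoms"
    by (auto simp: in_keys_iff lookup_sum_single supp_def simp del: One_nat_def split: if_splits)
  then show ?thesis unfolding supp_label_eq_mon monomials_def by blast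
qed

text \<open>The elements above \<open>k\<close> split into those not above \<open>a\<close> and
  those above both, which form the interval from \<open>sup a k\<close> to \<open>top\<close>. The
  additive form avoids truncated subtraction.\<close>

lemma lookup_xexp_add:
  assumes "k \<in> atoms"
  shows "lookup (xexp a) k + card {sup a k..top} = card {k..}"
proof -
  have "{k..} = {p. k \<in> supp p \<and> \<not> a \<le> p} \<union> {sup a k..top}"
    using assms by (auto simp: supp_def)
  moreover have "card \<dots> = card {p. k \<in> supp p \<and> \<not> a \<le> p} + card {sup a k..top}"
    by (rule card_Un_disjoint) auto
  ultimately show ?thesis by (simp add: lookup_xexp)
qed

lemma lookup_xexp_le_iff:
  assumes "k \<in> atoms"
  shows "lookup (xexp a) k \<le> lookup (xexp b) k \<longleftrightarrow> card {sup b k..top} \<le> card {sup a k..top}"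
  using lookup_xexp_add[OF assms, of a] lookup_xexp_add[OF assms, of b] by linarith

text \<open>An element above both \<open>a\<close> and \<open>k\<close> is above \<open>b\<close>,
  so whatever is counted for \<open>b\<close> is counted for \<open>a\<close>.\<close>

lemma lookup_xexp_mono:
  assumes "b \<le> sup a k"
  shows "lookup (xexp b) k \<le> lookup (xexp a) k"
  unfolding lookup_xexp using assms
  by (intro card_mono) (auto simp: supp_def dest: order_trans[of b "sup a k"])

text \<open>The element \<open>p\<close> itself is counted for \<open>a\<close> but not for
  \<open>b\<close>.\<close>

lemma lookup_xexp_strict_mono:
  assumes "b \<le> sup a k" "k \<in> supp p" "b \<le> p" "\<not> a \<le> p"
  shows "lookup (xexp b) k < lookup (xexp a) k"
  unfolding lookup_xexp
proof (intro psubset_card_mono psubsetI)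
  show "{q. k \<in> supp q \<and> \<not> b \<le> q} \<subseteq> {q. k \<in> supp q \<and> \<not> a \<le> q}"
    using assms(1) by (auto simp: supp_def dest: order_trans[of b "sup a k"])
  show "{q. k \<in> supp q \<and> \<not> b \<le> q} \<noteq> {q. k \<in> supp q \<and> \<not> a \<le> q}"
    using assms(2-4) by blast
qed simp

section \<open>Super-atomic lattices\<close>

lemma atoms_le_imp_eq: "a \<in> atoms \<Longrightarrow> b \<in> atoms \<Longrightarrow> a \<le> b \<Longrightarrow> a = b"
  by (auto simp: atoms_def order.order_iff_strict)

lemma supp_atom: "a \<in> atoms \<Longrightarrow> supp a = {a}"
  by (auto simp: supp_def atoms_def order.order_iff_strict)

lemma supp_bot: "supp bot = {}"
  by (auto simp: supp_def atoms_def bot_unique)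

lemma Sup_supp:
  assumes "atomic_lattice TYPE('p::{finite,complete_lattice})"
  shows "Sup (supp p) = (p::'p)"
proof (cases "p = bot")
  case False
  then obtain T where T: "T \<subseteq> atoms" "p = Sup T" using assms by (auto simp: atomic_lattice_def)
  then have "T \<subseteq> supp p" by (auto simp: supp_def Sup_upper)
  then have "p \<le> Sup (supp p)" using T Sup_subset_mono by metis
  moreover have "Sup (supp p) \<le> p" by (auto simp: supp_def intro: Sup_least)
  ultimately show ?thesis by simp
qed (simp add: supp_bot)

lemma super_atomic_pair:
  assumes "super_atomic TYPE('p::{finite,complete_lattice})"
    and "T \<subseteq> atoms" "Sup T = (p::'p)" "p \<noteq> bot" "p \<notin> atoms"
  obtains a b where "a \<in> T" "b \<in> T" "a \<noteq> b" "sup a b = p"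
proof -
  have "T \<in> join_sets p" using assms by (auto simp: join_sets_def supp_def Sup_upper)
  then show ?thesis using assms that unfolding super_atomic_def by meson
qed

text \<open>Super-atomicity for {a, b, c} yields a pair with the full join. The pair cannot be {b,
  c}, since \<open>a\<close> is not below \<open>sup b c\<close>; so it contains
  \<open>a\<close>.\<close>

lemma super_atomic_exchange:
  assumes "super_atomic TYPE('p::{finite,complete_lattice})"
    and a: "a \<in> atoms" and bc: "b \<in> atoms" "c \<in> atoms" and na: "\<not> (a::'p) \<le> sup b c"
  shows "sup a b = sup a (sup b c) \<or> sup a c = sup a (sup b c)"
proof -
  let ?q = "sup a (sup b c)"
  have "\<not> b \<le> a"
    using atoms_le_imp_eq[OF bc(1) a] na by auto
  then have "a \<noteq> ?q" by (metis le_sup_iff sup.cobounded1 sup.cobounded2)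
  then have "a < ?q" by (simp add: order.not_eq_order_implies_strict)
  then have "?q \<noteq> bot" "?q \<notin> atoms" using a by (auto simp: atoms_def)
  moreover have "Sup {a, b, c} = ?q" by simp
  ultimately obtain d e where de: "d \<in> {a, b, c}" "e \<in> {a, b, c}" "d \<noteq> e" "sup d e = ?q"
    using super_atomic_pair[OF assms(1), of "{a, b, c}"] a bc by (metis empty_subsetI insert_subset)
  moreover have "sup b c \<noteq> ?q" using na by (metis sup.cobounded1)
  ultimately show ?thesis by (auto simp: sup_commute)
qed

text \<open>The variable \<open>k\<close> shows that x(a) does not divide the lcm of the x(b) with b
  below \<open>p\<close>. The clause \<open>\<noteq> 0\<close> covers \<open>p = bot\<close>, where
  no \<open>b\<close> exists and the lcm is 1. A single atom would give x(a) = 1, which is why that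
  case is excluded.\<close>

lemma xexp_separates:
  fixes a p :: "'p::{finite,complete_lattice}"
  assumes SA: "super_atomic TYPE('p)" and card: "card (atoms :: 'p set) \<noteq> 1"
    and a: "a \<in> atoms" and na: "\<not> a \<le> p"
  obtains k where "lookup (xexp a) k \<noteq> 0" "\<And>b. b \<in> supp p \<Longrightarrow> lookup (xexp b) k < lookup (xexp a) k"
proof (cases "p = bot")
  case True
  have "atoms \<noteq> {a}" using card by (metis is_singletonI is_singleton_altdef)
  \<comment> \<open>The atom \<open>k\<close>, as an element of the lattice, lies above
    \<open>k\<close> but not above \<open>a\<close>, so the exponent of \<open>k\<close> in x(a) is
    positive.\<close>
  then obtain k where k: "k \<in> atoms" "k \<noteq> a" using a by auto
  then have "\<not> a \<le> k" "k \<in> supp k" using atoms_le_imp_eq[OF a k(1)] supp_atom[OF k(1)] by auto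
  then have "lookup (xexp a) k \<noteq> 0" by (auto simp: lookup_xexp)
  then show ?thesis using that True by (simp add: supp_bot)
next
  case False
  have "\<exists>b\<in>atoms. \<exists>c\<in>atoms. p = sup b c"
  proof (cases "p \<in> atoms")
    case True
    then show ?thesis by (intro bexI[of _ p]) auto
  next
    case np: False
    have "Sup (supp p) = p" using SA by (simp add: Sup_supp super_atomic_def)
    then show ?thesis using super_atomic_pair[OF SA _ _ False np, of "supp p"]
      by (metis (no_types, lifting) mem_Collect_eq subsetI supp_def)
  qed
  then obtain b c where bc: "b \<in> atoms" "c \<in> atoms" "p = sup b c" by auto
  then have "sup a b = sup a p \<or> sup a c = sup a p"
    using super_atomic_exchange[OF SA a bc(1,2)] na by blast
  moreover have "b \<in> supp p" "c \<in> supp p" using bc by (simp_all add: supp_def)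
  \<comment> \<open>Here \<open>k\<close> is one of the two atoms joining to \<open>p\<close>.
    Everything below \<open>p\<close> is then below \<open>sup a k\<close>, and \<open>p\<close>
    witnesses strictness.\<close>
  ultimately obtain k where k: "k \<in> supp p" "sup a k = sup a p" by blast
  have lt: "lookup (xexp b) k < lookup (xexp a) k" if "b \<in> supp p" for b
  proof (rule lookup_xexp_strict_mono[OF _ k(1) _ na])
    show "b \<le> p" using that by (simp add: supp_def)
    then show "b \<le> sup a k" by (simp add: k le_supI2)
  qed
  show ?thesis using that[of k] lt lt[OF k(1)] by simp
qed

text \<open>Allowing any \<open>A\<close> rather than \<open>supp p\<close> is what later makes the
  lcm over \<open>A\<close> depend only on \<open>Sup A\<close>. Super-atomicity picks the two
  dominating generators inside \<open>A\<close>.\<close>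

lemma xexp_dominated_by_generating_set:
  fixes A :: "'p::{finite,complete_lattice} set"
  assumes SA: "super_atomic TYPE('p)"
    and ineq: "\<And>(p::'p) ai aj ak ar. ai \<in> supp p \<Longrightarrow> aj \<in> supp p \<Longrightarrow> p = sup ai aj \<Longrightarrow>
      ak \<in> supp p \<Longrightarrow> ar \<in> supp p \<Longrightarrow> card {sup ai ak..top} \<le> card {sup ar ak..top} \<or>
        card {sup aj ak..top} \<le> card {sup ar ak..top}"
    and A: "A \<subseteq> atoms" and r: "r \<in> supp (Sup A)" and k: "k \<in> atoms"
  shows "\<exists>b\<in>A. lookup (xexp r) k \<le> lookup (xexp b) k"
proof -
  have nonbot: "Sup A \<noteq> bot" using r supp_bot by (metis empty_iff)
  show ?thesis
  proof (cases "Sup A \<in> atoms")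
    case True
    \<comment> \<open>When \<open>Sup A\<close> is an atom, both \<open>A\<close> and {r} equal {Sup
      A}.\<close>
    have "A \<noteq> {}" using nonbot by (metis Sup_empty)
    moreover have "A \<subseteq> supp (Sup A)" using A by (auto simp: supp_def Sup_upper)
    ultimately show ?thesis using r supp_atom[OF True] by auto
  next
    case False
    obtain i j where ij: "i \<in> A" "j \<in> A" "sup i j = Sup A"
      using super_atomic_pair[OF SA A refl nonbot False] by metis
    show ?thesis
    proof (cases "k \<le> Sup A")
      case True
      have "card {sup i k..top} \<le> card {sup r k..top} \<or> card {sup j k..top} \<le> card {sup r k..top}"
        by (rule ineq[of i "Sup A" j]) (use ij A k True r in \<open>auto simp: supp_def Sup_upper\<close>)
      then show ?thesis using ij lookup_xexp_le_iff[OF k] by blast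
    next
      case False
      \<comment> \<open>Exchange with \<open>k\<close> as the outside atom: joining \<open>k\<close>
        to \<open>i\<close> or to \<open>j\<close> already reaches everything below
        \<open>Sup A\<close>, in particular \<open>r\<close>.\<close>
      then have "sup k i = sup k (Sup A) \<or> sup k j = sup k (Sup A)"
        using super_atomic_exchange[OF SA k, of i j] ij A by auto
      moreover have "r \<le> sup k (Sup A)" using r by (simp add: supp_def le_supI2)
      ultimately have "r \<le> sup i k \<or> r \<le> sup j k" by (metis sup_commute)
      then show ?thesis using ij lookup_xexp_mono by blast
    qed
  qed
qed

section \<open>Minimal generators and lcm-lattice of the coordinate ideal\<close>

lemma min_gens_coord_ideal_supp_label:
  assumes SA: "super_atomic TYPE('p::{finite,complete_lattice})" and card: "card (atoms :: 'p set) \<noteq> 1"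
  shows "min_gens atoms (coord_ideal atoms (supp_label :: 'p \<Rightarrow> ('p, 'k::field) mpoly)) =
    mon ` xexp ` atoms"
proof -
  \<comment> \<open>Separation is applied with \<open>p\<close> the atom \<open>b\<close>, whose
    support is {b}.\<close>
  have antichain: "a = b" if ab: "a \<in> atoms" "b \<in> atoms" "(mon (xexp a) :: ('p, 'k) mpoly) dvd mon (xexp b)"
    for a b :: 'p
  proof (rule ccontr)
    assume "a \<noteq> b"
    then have "\<not> a \<le> b" using atoms_le_imp_eq[OF ab(1,2)] by auto
    then obtain k where "lookup (xexp b) k < lookup (xexp a) k"
      using xexp_separates[OF SA card ab(1)] supp_atom[OF ab(2)] by blast
    then show False using ab(3) unfolding mon_dvd_iff by (meson not_le)
  qed
  have xmon: "(xmon supp_label ` atoms :: ('p, 'k) mpoly set) = mon ` xexp ` atoms"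
    by (simp add: image_image xmon_supp_label)
  show ?thesis
    unfolding coord_ideal_def xmon
  proof (rule min_gens_antichain)
    show "(mon ` xexp ` atoms :: ('p, 'k) mpoly set) \<subseteq> monomials atoms"
      using keys_xexp unfolding monomials_def by blast
  next
    fix f g :: "('p, 'k) mpoly"
    assume "f \<in> mon ` xexp ` atoms" "g \<in> mon ` xexp ` atoms" and dvd: "f dvd g"
    then obtain a b where ab: "a \<in> atoms" "b \<in> atoms" "f = mon (xexp a)" "g = mon (xexp b)" by blast
    then have "a = b" using antichain dvd by simp
    then show "f = g" by (simp add: ab)
  qed
qed

text \<open>Subsets of the generators are images of sets of atoms, and lcms are unique. Different
  \<open>A\<close> may give the same monomial; \<open>A = {}\<close> gives 1.\<close>

lemma lcm_lattice_coord_ideal_supp_label: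
  assumes "super_atomic TYPE('p::{finite,complete_lattice})" "card (atoms :: 'p set) \<noteq> 1"
  shows "lcm_lattice atoms (coord_ideal atoms (supp_label :: 'p \<Rightarrow> ('p, 'k::field) mpoly)) =
    {mon (lcm_exp (xexp ` A)) | A. A \<subseteq> atoms}"
proof -
  have lcm: "is_lcm atoms (mon ` xexp ` A) (mon (lcm_exp (xexp ` A)) :: ('p, 'k) mpoly)" for A :: "'p set"
    by (rule is_lcm_lcm_exp) (use keys_xexp in auto)
  show ?thesis
    unfolding lcm_lattice_def min_gens_coord_ideal_supp_label[OF assms]
  proof (intro Collect_cong iffI)
    fix l :: "('p, 'k) mpoly"
    assume "\<exists>S\<subseteq>mon ` xexp ` atoms. is_lcm atoms S l"
    then obtain A where "A \<subseteq> atoms" "is_lcm atoms (mon ` xexp ` A) l"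
      by (auto simp: subset_image_iff)
    then show "\<exists>A. l = mon (lcm_exp (xexp ` A)) \<and> A \<subseteq> atoms"
      using is_lcm_unique[OF _ lcm] by blast
  next
    fix l :: "('p, 'k) mpoly"
    assume "\<exists>A. l = mon (lcm_exp (xexp ` A)) \<and> A \<subseteq> atoms"
    then show "\<exists>S\<subseteq>mon ` xexp ` atoms. is_lcm atoms S l"
      using lcm by (metis image_mono)
  qed
qed

section \<open>Lattice isomorphisms and the equivalence\<close>

lemma lattice_iso_if_order_iso:
  fixes g :: "'p::{finite,complete_lattice} \<Rightarrow> 'm"
  assumes "bij_betw g UNIV L" and "\<And>p q. le (g p) (g q) \<longleftrightarrow> p \<le> q"
  shows "lattice_iso le L g"
proof -
  have "L = range g" using assms(1) by (simp add: bij_betw_def)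
  then show ?thesis using assms by (auto simp: lattice_iso_def is_join_in_def is_meet_in_def)
qed

text \<open>Monotonicity of \<open>g\<close> is recovered from joins: \<open>g p\<close> is below
  \<open>g (sup p q)\<close>, which is \<open>g q\<close> when \<open>p \<le> q\<close>. Only
  transitivity of \<open>le\<close> is then required.\<close>

lemma lattice_iso_pair:
  assumes "lattice_iso le L g" "p \<le> sup a b" "z \<in> L" "le (g a) z" "le (g b) z" "transp le"
  shows "le (g p) z"
proof -
  have "le (g (sup a b)) z" using assms by (auto simp: lattice_iso_def is_join_in_def)
  moreover have "le (g p) (g (sup p (sup a b)))"
    using assms by (auto simp: lattice_iso_def is_join_in_def)
  ultimately show ?thesis using assms by (metis sup.absorb2 transpD)
qed

theorem theorem5p2:
  assumes "super_atomic TYPE('p::{finite,complete_lattice})"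
    and "card (atoms :: 'p set) \<noteq> 1"
  shows "strong_coordinatization (atoms :: 'p set) (supp_label :: 'p \<Rightarrow> ('p, 'k::field) mpoly) \<longleftrightarrow>
    (\<forall>p::'p. \<forall>ai \<in> supp p. \<forall>aj \<in> supp p. p = sup ai aj \<longrightarrow>
      (\<forall>ak \<in> supp p. \<forall>ar \<in> supp p.
        card {sup ai ak..top} \<le> card {sup ar ak..top} \<or>
        card {sup aj ak..top} \<le> card {sup ar ak..top}))"
    (is "?strong \<longleftrightarrow> ?ineq")
proof
  let ?x = "\<lambda>a. mon (xexp a) :: ('p, 'k) mpoly"
  let ?lcm = "\<lambda>A. mon (lcm_exp (xexp ` A)) :: ('p, 'k) mpoly"
  let ?L = "lcm_lattice atoms (coord_ideal atoms (supp_label :: 'p \<Rightarrow> ('p, 'k) mpoly))"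
  note L = lcm_lattice_coord_ideal_supp_label[OF assms, where 'k = 'k]
  have x_dvd_lcm: "?x a dvd ?lcm A \<longleftrightarrow>
      (\<forall>k. lookup (xexp a) k = 0 \<or> (\<exists>b\<in>A. lookup (xexp a) k \<le> lookup (xexp b) k))" for a A
    by (simp add: mon_dvd_iff le_lookup_lcm_exp_iff)
  {
    assume ?strong
    then obtain g where g: "lattice_iso (dvd) ?L g" "\<And>a. a \<in> atoms \<Longrightarrow> g a = ?x a"
      by (auto simp: strong_coordinatization_def xmon_supp_label)
    show ?ineq
    proof (intro allI ballI impI)
      fix p ai aj ak ar :: 'p
      assume a: "ai \<in> supp p" "aj \<in> supp p" "p = sup ai aj" "ak \<in> supp p" "ar \<in> supp p"
      then have at: "ai \<in> atoms" "aj \<in> atoms" "ak \<in> atoms" "ar \<in> atoms" by (auto simp: supp_def)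
      \<comment> \<open>This lcm is a common multiple of \<open>g ai\<close> and \<open>g aj\<close>
        in the lcm-lattice, so it is above \<open>g (sup ai aj)\<close> and hence above
        \<open>g ar\<close>.\<close>
      have "?lcm {ai, aj} \<in> ?L"
        unfolding L using at by (intro CollectI exI[of _ "{ai, aj}"]) simp
      moreover have "g ai dvd ?lcm {ai, aj}" "g aj dvd ?lcm {ai, aj}"
        unfolding g(2)[OF at(1)] g(2)[OF at(2)] x_dvd_lcm by auto
      moreover have "ar \<le> sup ai aj" using a by (simp add: supp_def)
      moreover have "transp ((dvd) :: ('p, 'k) mpoly \<Rightarrow> _)" by (auto intro: transpI dvd_trans)
      ultimately have "g ar dvd ?lcm {ai, aj}" using lattice_iso_pair[OF g(1), of ar ai aj] by simp
      \<comment> \<open>Compare exponents of the variable \<open>ak\<close>; if that of x(ar)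
        vanishes, the inequality is trivial.\<close>
      then have "lookup (xexp ar) ak \<le> lookup (xexp ai) ak \<or> lookup (xexp ar) ak \<le> lookup (xexp aj) ak"
        unfolding g(2)[OF at(4)] x_dvd_lcm by (metis empty_iff insert_iff le0)
      then show "card {sup ai ak..top} \<le> card {sup ar ak..top} \<or>
          card {sup aj ak..top} \<le> card {sup ar ak..top}"
        by (simp only: lookup_xexp_le_iff[OF at(3)])
    qed
  }
  {
    assume ?ineq
    \<comment> \<open>Domination gives one direction, separation the other. Hence divisibility of
      lcms mirrors the order of joins.\<close>
    have x_dvd: "?x a dvd ?lcm A \<longleftrightarrow> a \<le> Sup A" if "a \<in> atoms" "A \<subseteq> atoms" for a A
    proof
      assume "a \<le> Sup A"
      then have a: "a \<in> supp (Sup A)" using that by (simp add: supp_def)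
      have "\<exists>b\<in>A. lookup (xexp a) k \<le> lookup (xexp b) k" if "k \<in> atoms" for k
        by (rule xexp_dominated_by_generating_set[OF assms(1) _ \<open>A \<subseteq> atoms\<close> a that])
          (use \<open>?ineq\<close> in blast)
      moreover have "lookup (xexp a) k = 0" if "k \<notin> atoms" for k
        using that keys_xexp[of a] by (auto simp: in_keys_iff)
      ultimately show "?x a dvd ?lcm A" unfolding x_dvd_lcm by blast
    next
      assume dvd: "?x a dvd ?lcm A"
      show "a \<le> Sup A"
      proof (rule ccontr)
        assume "\<not> a \<le> Sup A"
        then obtain k where k: "lookup (xexp a) k \<noteq> 0"
            "\<And>b. b \<in> supp (Sup A) \<Longrightarrow> lookup (xexp b) k < lookup (xexp a) k"
          using xexp_separates[OF assms \<open>a \<in> atoms\<close>] by blast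
        have "A \<subseteq> supp (Sup A)" using \<open>A \<subseteq> atoms\<close> by (auto simp: supp_def Sup_upper)
        then show False using dvd k unfolding x_dvd_lcm by (metis not_le subsetD)
      qed
    qed
    have lcm_dvd: "?lcm A dvd ?lcm B \<longleftrightarrow> Sup A \<le> Sup B" if "A \<subseteq> atoms" "B \<subseteq> atoms" for A B
    proof -
      have "?lcm A dvd ?lcm B \<longleftrightarrow> (\<forall>a\<in>A. ?x a dvd ?lcm B)"
        by (auto simp: mon_dvd_iff lookup_lcm_exp_le_iff)
      also have "\<dots> \<longleftrightarrow> (\<forall>a\<in>A. a \<le> Sup B)" using x_dvd that by blast
      finally show ?thesis by (simp add: Sup_le_iff)
    qed
    \<comment> \<open>By \<open>lcm_dvd\<close>, any set of atoms with join \<open>p\<close> would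
      give the same monomial; \<open>supp p\<close> is a canonical choice.\<close>
    define g where "g p = ?lcm (supp p)" for p :: 'p
    have supp: "supp p \<subseteq> atoms" for p :: 'p by (auto simp: supp_def)
    have Sup_supp': "Sup (supp p) = p" for p :: 'p
      using assms(1) by (simp add: Sup_supp super_atomic_def)
    have g_dvd: "g p dvd g q \<longleftrightarrow> p \<le> q" for p q
      unfolding g_def lcm_dvd[OF supp supp] Sup_supp' ..
    have lcm_eq: "?lcm A = ?lcm B" if "A \<subseteq> atoms" "B \<subseteq> atoms" "Sup A = Sup B" for A B
    proof -
      have "?lcm A dvd ?lcm B" "?lcm B dvd ?lcm A" using that lcm_dvd by auto
      then show ?thesis
        by (intro monomials_dvd_antisym[of _ UNIV]) (auto simp: monomials_def)
    qed
    have "inj g"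
    proof (rule injI)
      fix p q assume "g p = g q"
      then have "g p dvd g q" "g q dvd g p" by simp_all
      then show "p = q" unfolding g_dvd by (rule order_antisym)
    qed
    moreover have "range g = ?L"
    proof (intro equalityI subsetI)
      fix l assume "l \<in> ?L"
      then obtain A where A: "A \<subseteq> atoms" "l = ?lcm A" unfolding L by blast
      have "l = g (Sup A)" unfolding g_def A(2) by (rule lcm_eq) (use A supp Sup_supp' in auto)
      then show "l \<in> range g" by simp
    next
      fix l assume "l \<in> range g"
      then obtain p where "l = ?lcm (supp p)" unfolding g_def by (elim rangeE)
      then show "l \<in> ?L" unfolding L using supp[of p] by (intro CollectI exI[of _ "supp p"] conjI)
    qed
    ultimately have "lattice_iso (dvd) ?L g"
      by (intro lattice_iso_if_order_iso) (auto simp: g_dvd bij_betw_def)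
    \<comment> \<open>An atom supports only itself, and the lcm of one monomial is that
      monomial.\<close>
    moreover have "g a = xmon supp_label a" if "a \<in> atoms" for a
    proof -
      have "lcm_exp {xexp a} = xexp a"
        by (rule poly_mapping_eqI) (simp add: lookup_lcm_exp)
      then show ?thesis using that by (simp add: g_def supp_atom xmon_supp_label)
    qed
    ultimately show ?strong
      unfolding strong_coordinatization_def using supp_label_in_monomials by blast
  }
qed

end
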